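(* Let $f\in G$ be an element with (unique) normal form $$f=f_{i_1}^{r_1}\cdots f_{i_n}^{r_n}\,f_{j_m}^{-s_m}\cdots f_{j_1}^{-s_1},$$ and let $D=r_1+\cdots+r_n+s_1+\cdots+s_m+i_n+j_m$. Then $$\frac{D}{6}-2\ \le\ |f|_G\ \le\ 3D.$$
   Context: For each integer $k\ge0$ let $f_k:\mathbb{R}\to\mathbb{R}$ be the piecewise linear homeomorphism with $f_k(t)=t$ if $t\le k$, $f_k(t)=2t-k$ if $k\le t\le k+1$, and $f_k(t)=t+1$ if $t\ge k+1$. $G$ is the group of homeomorphisms of $\mathbb{R}$ generated by all $f_k$, $k\ge0$, with right action: the product $fg$ in $G$ denotes the map $g\circ f$. With this convention $f_i^{-1}f_jf_i=f_{j+1}$ for $i<j$, and $G$ is isomorphic to Thompson's group $F=\langle x_k,\ k\ge 0 \mid x_i^{-1}x_jx_i=x_{j+1}\text{ if } i<j\rangle$ via $x_k\mapsto f_k$. $G$ is generated by $f_0,f_1$, and $|f|_G$ denotes the word norm of $f$ with respect to $\{f_0,f_1\}$ (the least length of a word in $f_0^{\pm1},f_1^{\pm1}$ representing $f$). Every element of $G$ has a unique normal form $f_{i_1}^{r_1}\cdots f_{i_n}^{r_n}f_{j_m}^{-s_m}\cdots f_{j_1}^{-s_1}$ in the generators $f_k$, $k\ge 0$, satisfying: (1) $r_1,\ldots,r_n,s_1,\ldots,s_m>0$; (2) $i_1<i_2<\cdots<i_n$; (3) $j_1<j_2<\cdots<j_m$; (4) $i_n\ne j_m$; and (5) if for some $i$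 both $f_i$ and $f_i^{-1}$ appear in the expression, then $f_{i+1}$ or $f_{i+1}^{-1}$ appears as well. The positive part or the negative part may be empty ($n=0$ or $m=0$), in which case condition (4) is void and the corresponding terms $r_1+\dots+r_n$ and $i_n$ (respectively $s_1+\dots+s_m$ and $j_m$) in $D$ are taken to be $0$. *)

theory Defs
  imports "HOL-Analysis.Analysis" "HOL-Algebra.Elementary_Groups"
begin

text \<open>Maps act on the right: the product of \<open>f\<close> and \<open>g\<close> is \<open>g \<circ> f\<close>.\<close>

definition Homeo_R :: "(real \<Rightarrow> real) monoid" where
  "Homeo_R = \<lparr>carrier = {f. \<exists>g. homeomorphism UNIV UNIV f g},
              mult = (\<lambda>f g. g \<circ> f), one = id\<rparr>"

definition thompson_gen :: "nat \<Rightarrow> real \<Rightarrow> real" where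
  "thompson_gen k t =
     (if t \<le> real k then t
      else if t \<le> real k + 1 then 2 * t - real k
      else t + 1)"

definition thompson_G :: "(real \<Rightarrow> real) monoid" where
  "thompson_G = subgroup_generated Homeo_R (range thompson_gen)"

definition list_prod :: "('a, 'b) monoid_scheme \<Rightarrow> 'a list \<Rightarrow> 'a" where
  "list_prod G w = foldr (mult G) w (one G)"

text \<open>The value is meaningful only for \<open>x\<close> in the subgroup generated by \<open>S\<close>;
  otherwise no such word exists and the \<open>LEAST\<close> is unspecified.\<close>

definition word_norm :: "('a, 'b) monoid_scheme \<Rightarrow> 'a set \<Rightarrow> 'a \<Rightarrow> nat" where
  "word_norm G S x =
     (LEAST l. \<exists>w. set w \<subseteq> S \<union> m_inv G ` S \<and> length w = l \<and> list_prod G w = x)"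

text \<open>The list \<open>P = [(i\<^sub>1, r\<^sub>1), \<dots>, (i\<^sub>n, r\<^sub>n)]\<close> encodes the positive part and
  \<open>N = [(j\<^sub>1, s\<^sub>1), \<dots>, (j\<^sub>m, s\<^sub>m)]\<close> the negative part; the latter occurs
  reversed, with negated exponents, in the product.\<close>

definition normal_form_of ::
    "(nat \<times> nat) list \<Rightarrow> (nat \<times> nat) list \<Rightarrow> (real \<Rightarrow> real) \<Rightarrow> bool" where
  "normal_form_of P N f \<longleftrightarrow>
     f = list_prod thompson_G
           (map (\<lambda>(i, r). thompson_gen i [^]\<^bsub>thompson_G\<^esub> int r) P @
            map (\<lambda>(j, s). thompson_gen j [^]\<^bsub>thompson_G\<^esub> (- int s)) (rev N)) \<and>
     (\<forall>(i, r) \<in> set P. r > 0) \<and> (\<forall>(j, s) \<in> set N. s > 0) \<and>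
     sorted_wrt (<) (map fst P) \<and>
     sorted_wrt (<) (map fst N) \<and>
     (P \<noteq> [] \<longrightarrow> N \<noteq> [] \<longrightarrow> fst (last P) \<noteq> fst (last N)) \<and>
     (\<forall>i. i \<in> fst ` set P \<longrightarrow> i \<in> fst ` set N \<longrightarrow>
          Suc i \<in> fst ` set P \<or> Suc i \<in> fst ` set N)"

definition last_index :: "(nat \<times> nat) list \<Rightarrow> nat" where
  "last_index P = (if P = [] then 0 else fst (last P))"

definition normal_form_D :: "(nat \<times> nat) list \<Rightarrow> (nat \<times> nat) list \<Rightarrow> nat" where
  "normal_form_D P N =
     sum_list (map snd P) + sum_list (map snd N) + last_index P + last_index N"

lemma group_Homeo_R: "group Homeo_R"
proof (rule groupI)
  fix f g assume "f \<in> carrier Homeo_R" "g \<in> carrier Homeo_R"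
  then show "f \<otimes>\<^bsub>Homeo_R\<^esub> g \<in> carrier Homeo_R"
    by (auto simp: Homeo_R_def intro: homeomorphism_compose)
next
  show "\<one>\<^bsub>Homeo_R\<^esub> \<in> carrier Homeo_R"
    by (auto simp: Homeo_R_def homeomorphism_def intro!: exI[of _ id])
next
  fix f assume "f \<in> carrier Homeo_R"
  then obtain g where g: "homeomorphism UNIV UNIV f g"
    by (auto simp: Homeo_R_def)
  then have "g \<circ> f = id" "f \<circ> g = id"
    by (auto simp: homeomorphism_def)
  moreover have "homeomorphism UNIV UNIV g f"
    using g by (rule homeomorphism_symD)
  ultimately show "\<exists>g \<in> carrier Homeo_R. g \<otimes>\<^bsub>Homeo_R\<^esub> f = \<one>\<^bsub>Homeo_R\<^esub>"
    by (auto simp: Homeo_R_def)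
qed (auto simp: Homeo_R_def o_assoc)

lemma thompson_gen_homeo: "thompson_gen k \<in> carrier Homeo_R"
proof -
  define g where "g = (\<lambda>t::real. min t (max ((t + real k) / 2) (t - 1)))"
  have f: "thompson_gen k = (\<lambda>t. max t (min (2 * t - real k) (t + 1)))"
    by (auto simp: thompson_gen_def fun_eq_iff max_def min_def)
  have 1: "g (thompson_gen k t) = t" for t
    by (auto simp: g_def thompson_gen_def max_def min_def field_simps)
  have 2: "thompson_gen k (g t) = t" for t
    by (auto simp: g_def thompson_gen_def max_def min_def field_simps)
  have "continuous_on UNIV (thompson_gen k)" "continuous_on UNIV g"
    unfolding f g_def by (intro continuous_intros; simp)+
  then have "homeomorphism UNIV UNIV (thompson_gen k) g"
    using 1 2 by (intro homeomorphismI) auto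
  then show ?thesis
    by (auto simp: Homeo_R_def)
qed

lemma group_thompson_G: "group thompson_G"
  unfolding thompson_G_def by (rule group.group_subgroup_generated[OF group_Homeo_R])

lemma thompson_gen_in_G: "thompson_gen k \<in> carrier thompson_G"
  unfolding thompson_G_def subgroup_generated_def
  using thompson_gen_homeo by (auto intro: generate.incl)

lemma thompson_gen_relation:
  assumes "i < j"
  shows "inv\<^bsub>thompson_G\<^esub> thompson_gen i \<otimes>\<^bsub>thompson_G\<^esub> thompson_gen j \<otimes>\<^bsub>thompson_G\<^esub> thompson_gen i
       = thompson_gen (Suc j)"
proof -
  interpret group thompson_G by (rule group_thompson_G)
  have "thompson_gen j \<otimes>\<^bsub>thompson_G\<^esub> thompson_gen i
      = thompson_gen i \<otimes>\<^bsub>thompson_G\<^esub> thompson_gen (Suc j)"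
    using assms
    by (auto simp: thompson_G_def subgroup_generated_def Homeo_R_def thompson_gen_def
        fun_eq_iff field_simps)
  then show ?thesis
    by (simp add: m_assoc thompson_gen_in_G inv_solve_left')
qed

end

theory Submission
  imports Defs
begin

text \<open>
  The bounds come from rewriting words with the relations \<open>x\<^sub>j x\<^sub>i = x\<^sub>i x\<^sub>j\<^sub>+\<^sub>1\<close> for \<open>i < j\<close>.

  Upper bound: for \<open>i \<ge> 1\<close>, \<open>x\<^sub>i\<close> is the conjugate of \<open>x\<^sub>1\<close> by the power \<open>i - 1\<close> of \<open>x\<^sub>0\<close>. In a
  positive word with weakly increasing indices the conjugating powers of consecutive letters
  telescope, so such a word costs its length plus twice its largest index
  (\<open>expressible_pos_word\<close>). Applied to both halves of the normal form, this gives a word norm of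
  at most \<open>2 D\<close>.

  Lower bound: start from a word of length \<open>L\<close> in \<open>x\<^sub>0\<close>, \<open>x\<^sub>1\<close> and their inverses and move positive
  letters to the left and negative letters to the right, each half in order of index. Every
  relation used keeps the number of letters, or cancels two, and the index of a letter rises by at
  most one each time it passes another letter. The result is a fraction \<open>p q\<inverse>\<close> of sorted
  positive words with at most \<open>L\<close> letters in total and all indices at most \<open>L\<close>
  (\<open>word_fraction\<close>). This fraction need not satisfy the condition on neighbouring indices that
  defines normal forms, but among all sorted fractions representing a given element the
  normal form has the shortest numerator and denominator and the smallest largest indices
  (\<open>reduced_minimal\<close>). Hence \<open>D \<le> L + L + L\<close>, and the word norm is even at least \<open>D / 3\<close>.

  Minimality rests on the germ of an element to the right of the smallest index \<open>i\<close> that occurs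
  in a fraction: all other letters are the identity there, so the slope records the exponent of
  \<open>x\<^sub>i\<close> in the numerator minus the exponent in the denominator. Two fractions of the same element
  therefore either share a letter \<open>x\<^sub>i\<close> that can be cancelled, or one of them starts and ends with
  \<open>x\<^sub>i\<close> while the other has all indices above \<open>i\<close> and so fixes every point up to \<open>i + 1\<close>. The former
  cannot be the normal form, because a normal form containing \<open>x\<^sub>i\<close> moves some of these points
  (\<open>reduced_support\<close>).
\<close>

section \<open>Positive words\<close>

text \<open>Maps act on the right, so the first letter is applied first.\<close>

primrec pos_word :: "nat list \<Rightarrow> real \<Rightarrow> real" where
  "pos_word [] = id"
| "pos_word (i # p) = pos_word p \<circ> thompson_gen i"

lemma thompson_gen_inverse_ex:
  obtains h where "h \<circ> thompson_gen k = id" "thompson_gen k \<circ> h = id"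
proof -
  obtain h where "homeomorphism UNIV UNIV (thompson_gen k) h"
    using thompson_gen_homeo[of k] by (auto simp: Homeo_R_def)
  then show ?thesis
    by (intro that[of h]) (simp_all add: homeomorphism_def fun_eq_iff)
qed

lemma bij_thompson_gen: "bij (thompson_gen k)"
  by (rule thompson_gen_inverse_ex) (rule o_bij)

lemma bij_pos_word: "bij (pos_word p)"
  by (induction p) (simp_all only: pos_word.simps bij_id bij_comp bij_thompson_gen)

lemma comp_thompson_gen_cancel:
  assumes "g \<circ> thompson_gen k = h \<circ> thompson_gen k"
  shows "g = h"
  using thompson_gen_inverse_ex[of k] assms by (metis comp_assoc comp_id)

lemma thompson_gen_comm:
  assumes "i < j"
  shows "thompson_gen i \<circ> thompson_gen j = thompson_gen (Suc j) \<circ> thompson_gen i"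
  using assms by (auto simp: thompson_gen_def fun_eq_iff)

text \<open>The defining relations, lifted to words: conjugation by \<open>x\<^sub>i\<close> shifts all larger indices.\<close>

lemma pos_word_conj:
  assumes "\<forall>x\<in>set p. i < x"
  shows "thompson_gen i \<circ> pos_word p = pos_word (map Suc p) \<circ> thompson_gen i"
  using assms
proof (induction p)
  case (Cons j p)
  have "thompson_gen i \<circ> pos_word (j # p) = (thompson_gen i \<circ> pos_word p) \<circ> thompson_gen j"
    by (simp add: o_assoc)
  also have "\<dots> = pos_word (map Suc p) \<circ> (thompson_gen i \<circ> thompson_gen j)"
    using Cons by (simp add: fun_eq_iff)
  also have "\<dots> = pos_word (map Suc (j # p)) \<circ> thompson_gen i"
    using Cons.prems by (simp add: thompson_gen_comm o_assoc)
  finally show ?case .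
qed simp

lemma pos_word_fixes:
  assumes "\<forall>x\<in>set p. m \<le> x" "t \<le> real m"
  shows "pos_word p t = t"
  using assms by (induction p) (auto simp: thompson_gen_def)

section \<open>Fractions of positive words\<close>

text \<open>This says \<open>f = p q\<inverse>\<close> in the group; multiplying out the denominator avoids inverse maps.\<close>

definition represents :: "nat list \<Rightarrow> nat list \<Rightarrow> (real \<Rightarrow> real) \<Rightarrow> bool" where
  "represents p q f \<longleftrightarrow> pos_word q \<circ> f = pos_word p"

lemma represents_cancel_left:
  assumes "represents (i # p) q f" "h \<circ> thompson_gen i = id" "thompson_gen i \<circ> h = id"
  shows "represents p q (f \<circ> h)"
  using assms unfolding represents_def by (simp add: o_assoc) (simp add: comp_assoc)

lemma represents_cancel_right:
  assumes "represents p (i # q) f"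
  shows "represents p q (thompson_gen i \<circ> f)"
  using assms unfolding represents_def by (simp add: o_assoc)

lemma represents_cancel_conj:
  assumes "represents (i # p) (i # q) f" "h \<circ> thompson_gen i = id" "thompson_gen i \<circ> h = id"
  shows "represents p q (thompson_gen i \<circ> f \<circ> h)"
  using represents_cancel_right represents_cancel_left assms by blast

lemma represents_shift:
  assumes "represents p q f" "\<forall>x\<in>set p \<union> set q. i < x"
    "h \<circ> thompson_gen i = id" "thompson_gen i \<circ> h = id"
  shows "represents (map Suc p) (map Suc q) (thompson_gen i \<circ> f \<circ> h)"
proof -
  have "pos_word (map Suc q) \<circ> (thompson_gen i \<circ> f \<circ> h) = (thompson_gen i \<circ> pos_word q) \<circ> f \<circ> h"
    using assms(2) by (simp add: pos_word_conj o_assoc)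
  also have "\<dots> = (thompson_gen i \<circ> pos_word p) \<circ> h"
    using assms(1) by (simp add: represents_def comp_assoc)
  also have "\<dots> = pos_word (map Suc p)"
    using assms(2,4) by (simp add: pos_word_conj comp_assoc)
  finally show ?thesis by (simp add: represents_def)
qed

text \<open>To the right of \<open>i\<close> a letter \<open>x\<^sub>i\<close> doubles the distance to \<open>i\<close> and larger letters do nothing
  until distance \<open>1\<close>. The sorting puts the doublings first, and the scaling of the argument
  keeps all intermediate points in the unit interval after \<open>i\<close>.\<close>

lemma pos_word_germ:
  assumes "sorted p" "\<forall>x\<in>set p. i \<le> x" "0 \<le> t" "t \<le> 1"
  shows "pos_word p (real i + t / 2 ^ count_list p i) = real i + t"
  using assms
proof (induction p)
  case (Cons j p)
  show ?case
  proof (cases "j = i")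
    case True
    have "t / 2 ^ count_list p i \<le> 1"
      using Cons.prems by (simp add: divide_le_eq) (metis order_trans one_le_power one_le_numeral)
    then have "thompson_gen i (real i + t / 2 ^ count_list (j # p) i)
        = real i + t / 2 ^ count_list p i"
      using True Cons.prems by (auto simp: thompson_gen_def field_simps)
    with Cons True show ?thesis by simp
  next
    case False
    with Cons.prems have "\<forall>x\<in>set (j # p). Suc i \<le> x" by auto
    then have "count_list (j # p) i = 0" "pos_word (j # p) (real i + t) = real i + t"
      using Cons.prems by (auto simp: count_list_0_iff simp del: pos_word.simps intro!: pos_word_fixes[of _ "Suc i"])
    then show ?thesis by simp
  qed
qed simp

lemma represents_germ:
  assumes "represents p q f" "sorted p" "sorted q" "\<forall>x\<in>set p \<union> set q. i \<le> x" "0 \<le> t" "t \<le> 1"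
  shows "f (real i + t / 2 ^ count_list p i) = real i + t / 2 ^ count_list q i"
proof -
  have "pos_word q (f (real i + t / 2 ^ count_list p i)) = pos_word p (real i + t / 2 ^ count_list p i)"
    using assms(1) by (metis represents_def comp_apply)
  also have "\<dots> = pos_word q (real i + t / 2 ^ count_list q i)"
    using assms by (simp add: pos_word_germ)
  finally show ?thesis
    using bij_pos_word by (metis bij_pointE)
qed

text \<open>Both sides determine the slope of \<open>f\<close> to the right of \<open>i\<close>, which is a power of two.\<close>

lemma represents_exponent_difference:
  assumes "represents p q f" "sorted p" "sorted q" "\<forall>x\<in>set p \<union> set q. i \<le> x"
    "represents p' q' f" "sorted p'" "sorted q'" "\<forall>x\<in>set p' \<union> set q'. i \<le> x"
  shows "count_list p i + count_list q' i = count_list p' i + count_list q i"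
proof -
  \<comment> \<open>a common sample point, close enough to \<open>i\<close> for both germ formulas\<close>
  define t :: real where "t = 1 / 2 ^ (count_list p i + count_list p' i)"
  have *: "f (real i + t) = real i + t * 2 ^ count_list p i / 2 ^ count_list q i"
    using represents_germ[OF assms(1-4), of "t * 2 ^ count_list p i"]
    by (simp add: t_def power_add mult.commute)
  have "f (real i + t) = real i + t * 2 ^ count_list p' i / 2 ^ count_list q' i"
    using represents_germ[OF assms(5-8), of "t * 2 ^ count_list p' i"]
    by (simp add: t_def power_add mult.commute)
  with * have "t * (2 ^ count_list p i / 2 ^ count_list q i) = t * (2 ^ count_list p' i / 2 ^ count_list q' i)"
    by simp
  moreover have "t \<noteq> 0" by (simp add: t_def)
  ultimately have "(2::real) ^ count_list p i / 2 ^ count_list q i = 2 ^ count_list p' i / 2 ^ count_list q' i"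
    by (metis mult_left_cancel)
  then have "(2::real) ^ (count_list p i + count_list q' i) = 2 ^ (count_list p' i + count_list q i)"
    by (simp add: power_add field_simps)
  then show ?thesis by simp
qed

lemma min_index_ex:
  fixes A :: "nat set"
  assumes "A \<noteq> {}"
  obtains i where "i \<in> A" "\<forall>x\<in>A. i \<le> x"
proof -
  obtain x where "x \<in> A" using assms by auto
  then show ?thesis
    by (intro that[of "LEAST x. x \<in> A"]) (auto intro: LeastI Least_le)
qed

lemma sorted_min_Cons:
  assumes "sorted p" "i \<in> set p" "\<forall>x\<in>set p. i \<le> x"
  obtains p1 where "p = i # p1"
  using assms by (cases p) (auto intro: order_antisym)

text \<open>The condition on neighbouring indices in a normal form, for words with repeated letters instead
  of exponents.\<close>

definition reduced :: "nat list \<Rightarrow> nat list \<Rightarrow> bool" where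
  "reduced p q \<longleftrightarrow> (\<forall>i\<in>set p \<inter> set q. Suc i \<in> set p \<union> set q)"

text \<open>Removing copies of the smallest index cannot remove a successor that the condition asks for.\<close>

lemma reduced_remove_min:
  assumes "reduced p q" "\<forall>x\<in>set p. i \<le> x"
    and "set p1 \<subseteq> set p" "set p \<subseteq> insert i (set p1)"
    and "set q1 \<subseteq> set q" "set q \<subseteq> insert i (set q1)"
  shows "reduced p1 q1"
  unfolding reduced_def
proof
  fix k assume k: "k \<in> set p1 \<inter> set q1"
  then have "Suc k \<in> set p \<union> set q" using assms by (auto simp: reduced_def)
  moreover have "Suc k \<noteq> i" using k assms(2,3) by fastforce
  ultimately show "Suc k \<in> set p1 \<union> set q1" using assms by blast
qed

text \<open>A reduced fraction shows all of its letters. If the smallest index \<open>i\<close> were less than \<open>m\<close>,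
  slope \<open>1\<close> at \<open>i\<close> would put \<open>x\<^sub>i\<close> into both halves. Stripping it off conjugates \<open>f\<close> by \<open>x\<^sub>i\<close>,
  which moves \<open>m\<close> to \<open>m + 1\<close>; by induction the remaining indices are at least \<open>m + 1 > i + 1\<close>,
  so the index \<open>i + 1\<close> required by reducedness is missing.\<close>

lemma reduced_support:
  assumes "represents p q f" "sorted p" "sorted q" "reduced p q" "\<And>t. t \<le> real m \<Longrightarrow> f t = t"
  shows "\<forall>x\<in>set p \<union> set q. m \<le> x"
  using assms
proof (induction "length p" arbitrary: p q f m rule: less_induct)
  case less
  note sorted = less.prems(2,3) and fix_f = less.prems(5)
  show ?case
  proof (rule ccontr)
    assume "\<not> ?thesis"
    then obtain x where x: "x \<in> set p \<union> set q" "x < m" using not_less by blast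
    then have "set p \<union> set q \<noteq> {}" by auto
    then obtain i where i: "i \<in> set p \<union> set q" "\<forall>x\<in>set p \<union> set q. i \<le> x"
      by (rule min_index_ex)
    then have "i < m" using x by (meson le_less_trans)
    have "real i + 1 / 2 ^ count_list p i \<le> real i + 1" by (simp add: divide_le_eq)
    also have "\<dots> \<le> real m" using \<open>i < m\<close> by linarith
    finally have "f (real i + 1 / 2 ^ count_list p i) = real i + 1 / 2 ^ count_list p i"
      by (rule fix_f)
    then have "count_list p i = count_list q i"
      using represents_germ[OF less.prems(1) sorted i(2), of 1] by simp
    then have "i \<in> set p" "i \<in> set q"
      using i(1) by (metis UnE count_list_0_iff)+
    then obtain p1 q1 where eq: "p = i # p1" "q = i # q1"
      using sorted i(2) by (metis UnCI sorted_min_Cons)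
    obtain h where h: "h \<circ> thompson_gen i = id" "thompson_gen i \<circ> h = id"
      by (rule thompson_gen_inverse_ex)
    have "(thompson_gen i \<circ> f \<circ> h) t = t" if "t \<le> real (Suc m)" for t
    proof -
      have t: "thompson_gen i (h t) = t" using h(2) by (metis comp_apply id_apply)
      then have "h t \<le> real m"
        using that \<open>i < m\<close> by (auto simp: thompson_gen_def split: if_splits)
      then show ?thesis using t fix_f by simp
    qed
    moreover have "reduced p1 q1"
      using reduced_remove_min[OF less.prems(4), of i p1 q1] i(2) by (auto simp: eq)
    ultimately have "\<forall>x\<in>set p1 \<union> set q1. Suc m \<le> x"
      using less.hyps[of p1 q1 "thompson_gen i \<circ> f \<circ> h" "Suc m"] sorted
        represents_cancel_conj[OF less.prems(1)[unfolded eq] h]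
      by (simp add: eq)
    moreover have "Suc i \<in> set p1 \<union> set q1"
      using less.prems(4) by (auto simp: reduced_def eq)
    ultimately have "Suc m \<le> Suc i" by (rule bspec)
    then show False using \<open>i < m\<close> by simp
  qed
qed

text \<open>Induction on the total number of letters, removing the smallest index \<open>i\<close> that occurs. By
  equality of the exponent differences, \<open>x\<^sub>i\<close> occurs in both numerators, in both denominators, or
  in both halves of exactly one fraction. In the first two cases it cancels. It cannot be the
  reduced fraction alone that contains it, by \<open>reduced_support\<close>. If it is the other one alone,
  stripping \<open>x\<^sub>i\<close> there amounts to shifting the indices of the reduced fraction, which only
  increases them.\<close>

lemma reduced_minimal:
  assumes "represents p q f" "sorted p" "sorted q" "reduced p q"
    and "represents p' q' f" "sorted p'" "sorted q'"
  shows "length p \<le> length p' \<and> length q \<le> length q' \<and>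
    (\<forall>M. set p' \<subseteq> {..M} \<longrightarrow> set p \<subseteq> {..M}) \<and> (\<forall>M. set q' \<subseteq> {..M} \<longrightarrow> set q \<subseteq> {..M})"
  using assms
proof (induction "length p' + length q' + length p + length q" arbitrary: f p q p' q' rule: less_induct)
  case less
  note rep = less.prems(1) and rep' = less.prems(5) and red = less.prems(4)
  note sorted = less.prems(2,3) and sorted' = less.prems(6,7)
  let ?A = "set p \<union> set q \<union> (set p' \<union> set q')"
  show ?case
  proof (cases "?A = {}")
    case False
    then obtain i where i: "i \<in> ?A" "\<forall>x\<in>?A. i \<le> x"
      by (rule min_index_ex)
    have cnt: "count_list p i + count_list q' i = count_list p' i + count_list q i"
      using i(2) by (intro represents_exponent_difference[OF rep sorted _ rep' sorted']) simp_all
    obtain h where h: "h \<circ> thompson_gen i = id" "thompson_gen i \<circ> h = id"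
      by (rule thompson_gen_inverse_ex)
    have dest: "\<exists>l1. l = i # l1" if "i \<in> set l" "l \<in> {p, q, p', q'}" for l
    proof -
      have "sorted l" "\<forall>x\<in>set l. i \<le> x" using that(2) i(2) sorted sorted' by auto
      then show ?thesis using that(1) by (metis sorted_min_Cons)
    qed
    consider (pp) "i \<in> set p" "i \<in> set p'" | (qq) "i \<in> set q" "i \<in> set q'"
      | (pq) "i \<in> set p" "i \<in> set q" "i \<notin> set p'" "i \<notin> set q'"
      | (pq') "i \<in> set p'" "i \<in> set q'" "i \<notin> set p" "i \<notin> set q"
      using i(1) cnt count_list_0_iff[of p i] count_list_0_iff[of q i]
        count_list_0_iff[of p' i] count_list_0_iff[of q' i] by auto
    then show ?thesis
    proof cases
      case pp
      then obtain p1 p1' where eq: "p = i # p1" "p' = i # p1'"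
        using dest by blast
      have "reduced p1 q"
        using reduced_remove_min[OF red, of i p1 q] i(2) by (auto simp: eq)
      then show ?thesis
        using less.hyps[of p1' q' p1 q "f \<circ> h"] sorted sorted'
          represents_cancel_left[OF rep[unfolded eq] h] represents_cancel_left[OF rep'[unfolded eq] h]
        by (simp add: eq)
    next
      case qq
      then obtain q1 q1' where eq: "q = i # q1" "q' = i # q1'"
        using dest by blast
      have "reduced p q1"
        using reduced_remove_min[OF red, of i p q1] i(2) by (auto simp: eq)
      then show ?thesis
        using less.hyps[of p' q1' p q1 "thompson_gen i \<circ> f"] sorted sorted'
          represents_cancel_right[OF rep[unfolded eq]] represents_cancel_right[OF rep'[unfolded eq]]
        by (simp add: eq)
    next
      case pq
      have gt: "\<forall>x\<in>set p' \<union> set q'. Suc i \<le> x"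
      proof
        fix x assume "x \<in> set p' \<union> set q'"
        then have "i \<le> x" "x \<noteq> i" using pq i(2) by auto
        then show "Suc i \<le> x" by simp
      qed
      have "f t = t" if "t \<le> real (Suc i)" for t
      proof -
        have "pos_word q' (f t) = pos_word p' t"
          using rep' by (metis represents_def comp_apply)
        also have "\<dots> = pos_word q' t"
          using gt that pos_word_fixes[of p' "Suc i" t] pos_word_fixes[of q' "Suc i" t] by simp
        finally show ?thesis using bij_pos_word by (metis bij_pointE)
      qed
      then have "\<forall>x\<in>set p \<union> set q. Suc i \<le> x"
        by (rule reduced_support[OF rep sorted red])
      with pq(1) have "Suc i \<le> i" by blast
      then show ?thesis by simp
    next
      case pq'
      then obtain p1' q1' where eq: "p' = i # p1'" "q' = i # q1'"
        using dest by blast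
      have gt: "\<forall>x\<in>set p \<union> set q. i < x"
      proof
        fix x assume "x \<in> set p \<union> set q"
        then have "i \<le> x" "x \<noteq> i" using pq' i(2) by auto
        then show "i < x" by simp
      qed
      have "reduced (map Suc p) (map Suc q)"
        using red by (auto simp: reduced_def)
      then have *: "length (map Suc p) \<le> length p1' \<and> length (map Suc q) \<le> length q1' \<and>
        (\<forall>M. set p1' \<subseteq> {..M} \<longrightarrow> set (map Suc p) \<subseteq> {..M}) \<and>
        (\<forall>M. set q1' \<subseteq> {..M} \<longrightarrow> set (map Suc q) \<subseteq> {..M})"
        using sorted sorted' represents_shift[OF rep gt h] represents_cancel_conj[OF rep'[unfolded eq] h]
        by (intro less.hyps) (auto simp: eq sorted_map sorted_wrt_map)
      have unshift: "set l \<subseteq> {..M}" if "set (map Suc l) \<subseteq> {..M}" for l M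
        using that by auto
      have "set p \<subseteq> {..M}" if "set p' \<subseteq> {..M}" for M
        by (rule unshift) (use * that in \<open>simp add: eq\<close>)
      moreover have "set q \<subseteq> {..M}" if "set q' \<subseteq> {..M}" for M
        by (rule unshift) (use * that in \<open>simp add: eq\<close>)
      ultimately show ?thesis
        using * by (simp add: eq)
    qed
  qed simp
qed

section \<open>Short words have short fractions\<close>

lemma thompson_mult: "f \<otimes>\<^bsub>thompson_G\<^esub> g = g \<circ> f"
  by (simp add: thompson_G_def subgroup_generated_def Homeo_R_def)

lemma thompson_one: "\<one>\<^bsub>thompson_G\<^esub> = id"
  by (simp add: thompson_G_def subgroup_generated_def Homeo_R_def)

text \<open>A letter appended to a sorted word moves left past larger letters, which it raises by one.\<close>

lemma sorted_pos_word_snoc: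
  assumes "sorted q"
  shows "\<exists>q'. sorted q' \<and> pos_word q' = thompson_gen k \<circ> pos_word q \<and>
    length q' = Suc (length q) \<and> set q' \<subseteq> insert k (set q \<union> Suc ` set q)"
  using assms
proof (induction q)
  case Nil
  show ?case by (rule exI[of _ "[k]"]) simp
next
  case (Cons j q)
  show ?case
  proof (cases "j \<le> k")
    case True
    have "sorted q" using Cons.prems by simp
    from Cons.IH[OF this] obtain q' where q': "sorted q'"
      "pos_word q' = thompson_gen k \<circ> pos_word q"
      "length q' = Suc (length q)" "set q' \<subseteq> insert k (set q \<union> Suc ` set q)" by blast
    have "\<forall>x\<in>set q'. j \<le> x" using q'(4) True Cons.prems by fastforce
    then show ?thesis using q' by (intro exI[of _ "j # q'"]) (auto simp: fun_eq_iff)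
  next
    case False
    then have "\<forall>x\<in>set (j # q). k < x" using Cons.prems by auto
    from pos_word_conj[OF this] this show ?thesis using Cons.prems
      by (intro exI[of _ "k # map Suc (j # q)"]) (auto simp: sorted_map less_imp_le fun_eq_iff)
  qed
qed

text \<open>A letter put in front of a sorted word moves right past smaller letters. Each of them raises its
  index by one, whereas the passed letters keep theirs.\<close>

lemma sorted_pos_word_Cons:
  assumes "sorted p"
  shows "\<exists>p'. sorted p' \<and> pos_word p' = pos_word p \<circ> thompson_gen k \<and>
    length p' = Suc (length p) \<and> set p' \<subseteq> set p \<union> {k..k + length p}"
  using assms
proof (induction p arbitrary: k)
  case Nil
  show ?case by (rule exI[of _ "[k]"]) simp
next
  case (Cons i p)
  show ?case
  proof (cases "k \<le> i")
    case True
    then show ?thesis using Cons.prems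
      by (intro exI[of _ "k # i # p"]) auto
  next
    case False
    have "sorted p" using Cons.prems by simp
    from Cons.IH[OF this, of "Suc k"] obtain p' where p': "sorted p'"
      "pos_word p' = pos_word p \<circ> thompson_gen (Suc k)"
      "length p' = Suc (length p)" "set p' \<subseteq> set p \<union> {Suc k..Suc k + length p}" by blast
    have "\<forall>x\<in>set p'. i \<le> x" using p'(4) False Cons.prems by fastforce
    moreover have "pos_word (i # p') = pos_word (i # p) \<circ> thompson_gen k"
      using p'(2) False by (simp add: comp_assoc thompson_gen_comm)
    moreover have "set (i # p') \<subseteq> set (i # p) \<union> {k..k + length (i # p)}"
      using p'(4) by fastforce
    ultimately show ?thesis using p'(1,3)
      by (intro exI[of _ "i # p'"]) simp
  qed
qed

text \<open>An inverse letter \<open>x\<^sub>k\<inverse>\<close> in front of a sorted word moves right. Smaller letters raise its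
  index. Once it meets an equal letter it cancels, and once all remaining letters are larger it
  raises each of them by one and emerges on the far side as the inverse of the letter with index \<open>k'\<close>.\<close>

lemma sorted_pos_word_divide:
  assumes "sorted p"
  shows "(\<exists>p'. sorted p' \<and> pos_word p = pos_word p' \<circ> thompson_gen k \<and>
      Suc (length p') = length p \<and> set p' \<subseteq> set p) \<or>
    (\<exists>p' k'. sorted p' \<and> thompson_gen k' \<circ> pos_word p = pos_word p' \<circ> thompson_gen k \<and>
      length p' = length p \<and> set p' \<subseteq> set p \<union> Suc ` set p \<and> k' \<le> k + length p)"
  using assms
proof (induction p arbitrary: k)
  case Nil
  show ?case by (rule disjI2, rule exI[of _ "[]"], rule exI[of _ k]) simp
next
  case (Cons i p)
  consider "i = k" | "k < i" | "i < k" by linarith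
  then show ?case
  proof cases
    case 1
    then show ?thesis using Cons.prems by (intro disjI1 exI[of _ p]) auto
  next
    case 2
    then have "\<forall>x\<in>set (i # p). k < x" using Cons.prems by auto
    from pos_word_conj[OF this] show ?thesis using Cons.prems
      by (intro disjI2 exI[of _ "map Suc (i # p)"] exI[of _ k]) (auto simp: sorted_map fun_eq_iff)
  next
    case 3
    have swap: "pos_word p' \<circ> thompson_gen (Suc k) \<circ> thompson_gen i = pos_word (i # p') \<circ> thompson_gen k" for p'
      using 3 by (simp add: comp_assoc thompson_gen_comm)
    have "sorted p" using Cons.prems by simp
    from Cons.IH[OF this, of "Suc k"] show ?thesis
    proof (elim disjE exE conjE)
      fix p' assume p': "sorted p'" "pos_word p = pos_word p' \<circ> thompson_gen (Suc k)"
        "Suc (length p') = length p" "set p' \<subseteq> set p"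
      then have "sorted (i # p')" using Cons.prems by auto
      then show ?thesis using p' swap[of p']
        by (intro disjI1 exI[of _ "i # p'"]) auto
    next
      fix p' k' assume p': "sorted p'"
        "thompson_gen k' \<circ> pos_word p = pos_word p' \<circ> thompson_gen (Suc k)"
        "length p' = length p" "set p' \<subseteq> set p \<union> Suc ` set p" "k' \<le> Suc k + length p"
      then have "sorted (i # p')" using Cons.prems by fastforce
      moreover have "thompson_gen k' \<circ> pos_word (i # p) = pos_word (i # p') \<circ> thompson_gen k"
        using p'(2) swap[of p'] by (simp add: o_assoc)
      ultimately show ?thesis using p'
        by (intro disjI2 exI[of _ "i # p'"] exI[of _ k']) (auto simp: fun_eq_iff)
    qed
  qed
qed

text \<open>Letters are added at the front of the word. The bound on the indices survives because a new
  letter starts with index at most \<open>1\<close> and passes at most \<open>length w\<close> others, while the indices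
  of the old letters rise by at most one.\<close>

lemma word_fraction:
  assumes "set w \<subseteq> {thompson_gen 0, thompson_gen 1} \<union> m_inv thompson_G ` {thompson_gen 0, thompson_gen 1}"
  shows "\<exists>p q. sorted p \<and> sorted q \<and> represents p q (list_prod thompson_G w) \<and>
    length p + length q \<le> length w \<and> set p \<union> set q \<subseteq> {..length w}"
  using assms
proof (induction w)
  case Nil
  show ?case by (intro exI[of _ "[]"]) (simp add: represents_def list_prod_def thompson_one fun_eq_iff)
next
  case (Cons a w)
  interpret group thompson_G by (rule group_thompson_G)
  define f where "f = list_prod thompson_G w"
  have prod: "list_prod thompson_G (a # w) = f \<circ> a"
    by (simp add: f_def list_prod_def thompson_mult)
  from Cons obtain p q where pq: "sorted p" "sorted q" "pos_word q \<circ> f = pos_word p"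
    "length p + length q \<le> length w" "set p \<union> set q \<subseteq> {..length w}"
    by (auto simp: f_def represents_def)
  from Cons.prems obtain k where "k \<le> 1" "a = thompson_gen k \<or> a = inv\<^bsub>thompson_G\<^esub> thompson_gen k"
    by force
  then consider "a = thompson_gen k" | "a = inv\<^bsub>thompson_G\<^esub> thompson_gen k" by blast
  then show ?case
  proof cases
    case 1
    from sorted_pos_word_Cons[OF pq(1), of k] obtain p' where
      p': "sorted p'" "pos_word p' = pos_word p \<circ> thompson_gen k"
        "length p' = Suc (length p)" "set p' \<subseteq> set p \<union> {k..k + length p}" by blast
    have "set p' \<subseteq> {..length (a # w)}"
      using p'(4) pq(4,5) \<open>k \<le> 1\<close> by fastforce
    moreover have "set q \<subseteq> {..length (a # w)}" using pq(5) by auto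
    moreover have "represents p' q (f \<circ> a)"
      using 1 p'(2) pq(3) by (simp add: represents_def o_assoc)
    ultimately show ?thesis
      using p' pq unfolding prod
        by - (rule exI[of _ p'], rule exI[of _ q], intro conjI; (assumption | auto))
  next
    case 2
    have "thompson_gen k \<otimes>\<^bsub>thompson_G\<^esub> a = \<one>\<^bsub>thompson_G\<^esub>"
      using thompson_gen_in_G 2 by simp
    then have a: "a \<circ> thompson_gen k = id" by (simp add: thompson_mult thompson_one)
    have rep: "represents p' q' (f \<circ> a)"
      if "pos_word q' = g \<circ> pos_word q" "g \<circ> pos_word p = pos_word p' \<circ> thompson_gen k" for p' q' g
    proof -
      have "pos_word q' \<circ> (f \<circ> a) \<circ> thompson_gen k = g \<circ> (pos_word q \<circ> f) \<circ> (a \<circ> thompson_gen k)"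
        by (simp add: that(1) comp_assoc)
      also have "\<dots> = pos_word p' \<circ> thompson_gen k"
        using a pq(3) that(2) by simp
      finally show ?thesis
        unfolding represents_def by (rule comp_thompson_gen_cancel)
    qed
    from sorted_pos_word_divide[OF pq(1), of k] show ?thesis
    proof (elim disjE exE conjE)
      fix p' assume p': "sorted p'" "pos_word p = pos_word p' \<circ> thompson_gen k"
        "Suc (length p') = length p" "set p' \<subseteq> set p"
      have "represents p' q (f \<circ> a)" using rep[of q id p'] p'(2) by simp
      then show ?thesis
        using p' pq unfolding prod
        by - (rule exI[of _ p'], rule exI[of _ q], intro conjI; (assumption | auto))
    next
      fix p' k' assume p': "sorted p'"
        "thompson_gen k' \<circ> pos_word p = pos_word p' \<circ> thompson_gen k"
        "length p' = length p" "set p' \<subseteq> set p \<union> Suc ` set p" "k' \<le> k + length p"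
      from sorted_pos_word_snoc[OF pq(2), of k'] obtain q' where
        q': "sorted q'" "pos_word q' = thompson_gen k' \<circ> pos_word q"
          "length q' = Suc (length q)" "set q' \<subseteq> insert k' (set q \<union> Suc ` set q)" by blast
      have "set p' \<subseteq> {..length (a # w)}" using p'(4) pq(5) by fastforce
      moreover have "set q' \<subseteq> {..length (a # w)}"
        using q'(4) pq(4,5) p'(5) \<open>k \<le> 1\<close> by fastforce
      ultimately show ?thesis
        using p' q' pq rep[OF q'(2) p'(2)] unfolding prod
        by - (rule exI[of _ p'], rule exI[of _ q'], intro conjI; (assumption | auto))
    qed
  qed
qed

section \<open>Words of bounded length in a group\<close>

text \<open>An upper bound for the word norm that also guarantees the existence of a word, so that the least
  length is attained.\<close>

definition expressible :: "('a, 'b) monoid_scheme \<Rightarrow> 'a set \<Rightarrow> nat \<Rightarrow> 'a \<Rightarrow> bool" where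
  "expressible G S n x \<longleftrightarrow>
     (\<exists>w. set w \<subseteq> S \<union> m_inv G ` S \<and> length w \<le> n \<and> list_prod G w = x)"

lemma word_norm_le:
  assumes "expressible G S n x"
  shows "word_norm G S x \<le> n"
proof -
  obtain w where "set w \<subseteq> S \<union> m_inv G ` S" "length w \<le> n" "list_prod G w = x"
    using assms unfolding expressible_def by blast
  then show ?thesis
    unfolding word_norm_def by (intro order_trans[OF Least_le[of _ "length w"]]) auto
qed

lemma word_norm_word:
  assumes "expressible G S n x"
  obtains w where "set w \<subseteq> S \<union> m_inv G ` S" "length w = word_norm G S x" "list_prod G w = x"
proof -
  have "\<exists>l w. set w \<subseteq> S \<union> m_inv G ` S \<and> length w = l \<and> list_prod G w = x"
    using assms by (auto simp: expressible_def)
  from LeastI_ex[OF this] show ?thesis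
    using that by (auto simp: word_norm_def)
qed

lemma expressible_mono: "expressible G S n x \<Longrightarrow> n \<le> m \<Longrightarrow> expressible G S m x"
  by (force simp: expressible_def)

lemma expressible_one: "expressible G S n \<one>\<^bsub>G\<^esub>"
  unfolding expressible_def by (rule exI[of _ "[]"]) (simp add: list_prod_def)

context group
begin

lemma list_prod_closed: "set w \<subseteq> carrier G \<Longrightarrow> list_prod G w \<in> carrier G"
  by (induction w) (auto simp: list_prod_def)

lemma list_prod_append:
  "set u \<subseteq> carrier G \<Longrightarrow> set v \<subseteq> carrier G \<Longrightarrow>
    list_prod G (u @ v) = list_prod G u \<otimes> list_prod G v"
  using list_prod_closed[of v]
  by (induction u) (auto simp: list_prod_def m_assoc list_prod_closed[unfolded list_prod_def])

lemma inv_list_prod: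
  "set w \<subseteq> carrier G \<Longrightarrow> inv (list_prod G w) = list_prod G (rev (map (m_inv G) w))"
proof (induction w)
  case (Cons a w)
  have "inv (list_prod G (a # w)) = inv (a \<otimes> list_prod G w)"
    by (simp add: list_prod_def)
  also have "\<dots> = inv (list_prod G w) \<otimes> inv a"
    using Cons.prems by (simp add: inv_mult_group list_prod_closed)
  also have "\<dots> = list_prod G (rev (map (m_inv G) w)) \<otimes> list_prod G [inv a]"
    using Cons by (simp add: list_prod_def)
  also have "\<dots> = list_prod G (rev (map (m_inv G) (a # w)))"
    using Cons.prems by (subst list_prod_append[symmetric]) auto
  finally show ?case .
qed (simp add: list_prod_def)

lemma expressible_gen:
  assumes "x \<in> S" "S \<subseteq> carrier G"
  shows "expressible G S 1 x"
  unfolding expressible_def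
  using assms by (intro exI[of _ "[x]"]) (auto simp: list_prod_def)

lemma expressible_mult:
  assumes "S \<subseteq> carrier G" "expressible G S m x" "expressible G S n y"
  shows "expressible G S (m + n) (x \<otimes> y)"
proof -
  obtain u v where uv: "set u \<subseteq> S \<union> m_inv G ` S" "length u \<le> m" "list_prod G u = x"
    "set v \<subseteq> S \<union> m_inv G ` S" "length v \<le> n" "list_prod G v = y"
    using assms(2,3) by (auto simp: expressible_def)
  moreover have "S \<union> m_inv G ` S \<subseteq> carrier G" using assms(1) by auto
  ultimately have "list_prod G (u @ v) = x \<otimes> y"
    using list_prod_append[of u v] by auto
  with uv show ?thesis
    unfolding expressible_def by (intro exI[of _ "u @ v"]) auto
qed

lemma expressible_inv:
  assumes "S \<subseteq> carrier G" "expressible G S n x"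
  shows "expressible G S n (inv x)"
proof -
  obtain u where u: "set u \<subseteq> S \<union> m_inv G ` S" "length u \<le> n" "list_prod G u = x"
    using assms(2) by (auto simp: expressible_def)
  moreover have "S \<union> m_inv G ` S \<subseteq> carrier G" using assms(1) by auto
  ultimately have "inv x = list_prod G (rev (map (m_inv G) u))"
    using inv_list_prod[of u] by auto
  moreover have "m_inv G ` set u \<subseteq> S \<union> m_inv G ` S"
    using u(1) assms(1) by (force simp: subset_iff)
  ultimately show ?thesis
    using u(2) unfolding expressible_def
    by (intro exI[of _ "rev (map (m_inv G) u)"]) auto
qed

end

section \<open>Positive words in the two generators\<close>

lemma pos_word_in_G: "pos_word p \<in> carrier thompson_G"
proof (induction p)
  case Nil
  interpret group thompson_G by (rule group_thompson_G)
  show ?case using one_closed unfolding thompson_one by (simp only: pos_word.simps)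
next
  case (Cons i p)
  interpret group thompson_G by (rule group_thompson_G)
  show ?case
    using m_closed[OF thompson_gen_in_G Cons, of i] unfolding thompson_mult pos_word.simps .
qed

text \<open>Letters \<open>x\<^sub>0\<close> and \<open>x\<^sub>1\<close> at the front are generators and are split off. When only larger indices
  are left, the whole word is the conjugate by \<open>x\<^sub>0\<close> of the word with all indices lowered by one,
  at the cost of two letters; this happens at most \<open>M\<close> times. The bound \<open>Suc M\<close> on the indices
  matches the stop at index \<open>1\<close>.\<close>

lemma expressible_pos_word:
  assumes "sorted p" "set p \<subseteq> {..Suc M}"
  shows "expressible thompson_G {thompson_gen 0, thompson_gen 1} (length p + 2 * M) (pos_word p)"
    (is "expressible _ ?S _ _")
  using assms
proof (induction "length p + M" arbitrary: p M rule: less_induct)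
  case less
  interpret group thompson_G by (rule group_thompson_G)
  have S: "?S \<subseteq> carrier thompson_G" using thompson_gen_in_G by auto
  show ?case
  proof (cases p)
    case Nil
    then show ?thesis
      using expressible_one[of thompson_G] by (simp add: thompson_one)
  next
    case (Cons i p1)
    show ?thesis
    proof (cases "i \<le> 1")
      case True
      then have "thompson_gen i \<in> ?S" by (cases i) auto
      then have "expressible thompson_G ?S 1 (thompson_gen i)"
        by (rule expressible_gen[OF _ S])
      moreover have "expressible thompson_G ?S (length p1 + 2 * M) (pos_word p1)"
        using less.prems by (intro less.hyps) (auto simp: Cons)
      ultimately have "expressible thompson_G ?S (1 + (length p1 + 2 * M))
          (thompson_gen i \<otimes>\<^bsub>thompson_G\<^esub> pos_word p1)"
        by (rule expressible_mult[OF S])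
      then show ?thesis by (simp add: Cons thompson_mult)
    next
      case False
      define p' where "p' = map (\<lambda>x. x - 1) p"
      have gt: "\<forall>x\<in>set p. 1 < x" using False less.prems(1) by (auto simp: Cons)
      then have p: "p = map Suc p'" "\<forall>x\<in>set p'. 0 < x"
        by (auto simp: p'_def o_def intro!: map_idI[symmetric])
      have M: "M > 0" using False less.prems(2) by (auto simp: Cons)
      have "thompson_gen 0 \<circ> pos_word p' = pos_word p \<circ> thompson_gen 0"
        using pos_word_conj[OF p(2)] by (simp add: p(1))
      then have "pos_word p' \<otimes>\<^bsub>thompson_G\<^esub> thompson_gen 0
          = thompson_gen 0 \<otimes>\<^bsub>thompson_G\<^esub> pos_word p"
        by (simp add: thompson_mult)
      then have eq: "pos_word p = inv\<^bsub>thompson_G\<^esub> thompson_gen 0 \<otimes>\<^bsub>thompson_G\<^esub>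
          (pos_word p' \<otimes>\<^bsub>thompson_G\<^esub> thompson_gen 0)"
        using pos_word_in_G thompson_gen_in_G by (simp add: inv_solve_left)
      have "sorted p'" using less.prems(1) by (simp add: p(1) sorted_map)
      moreover have "set p' \<subseteq> {..Suc (M - 1)}"
        using less.prems(2) M by (auto simp: p(1))
      ultimately have p': "expressible thompson_G ?S (length p' + 2 * (M - 1)) (pos_word p')"
        using M by (intro less.hyps) (auto simp: p(1))
      have x0: "expressible thompson_G ?S 1 (thompson_gen 0)"
        by (rule expressible_gen[OF _ S]) simp
      have "expressible thompson_G ?S (1 + ((length p' + 2 * (M - 1)) + 1)) (pos_word p)"
        unfolding eq by (intro expressible_mult expressible_inv S p' x0)
      then show ?thesis
        using M by (auto simp: p(1) intro: expressible_mono)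
    qed
  qed
qed

section \<open>Normal forms\<close>

definition letters :: "(nat \<times> nat) list \<Rightarrow> nat list" where
  "letters P = concat (map (\<lambda>(i, r). replicate r i) P)"

lemma letters_simps [simp]:
  "letters [] = []" "letters ((i, r) # P) = replicate r i @ letters P"
  by (simp_all add: letters_def)

lemma length_letters: "length (letters P) = sum_list (map snd P)"
  by (induction P) auto

lemma set_letters:
  assumes "\<forall>(i, r) \<in> set P. r > 0"
  shows "set (letters P) = fst ` set P"
proof -
  have "set (replicate r i) = {i}" if "r > 0" for i r :: nat
    using that by (simp add: set_replicate_conv_if)
  then show ?thesis
    using assms unfolding letters_def by (auto simp: split_beta image_iff Bex_def)
qed

lemma sorted_letters:
  assumes "sorted_wrt (<) (map fst P)"
  shows "sorted (letters P)"
proof -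
  have "set (letters Q) \<subseteq> fst ` set Q" for Q
    by (induction Q) auto
  with assms show ?thesis
    by (induction P) (fastforce simp: sorted_append)+
qed

lemma letters_le_last_index:
  assumes "\<forall>(i, r) \<in> set P. r > 0" "sorted_wrt (<) (map fst P)"
  shows "set (letters P) \<subseteq> {..last_index P}"
proof (cases P rule: rev_cases)
  case (snoc Q a)
  with assms show ?thesis
    by (auto simp: set_letters last_index_def sorted_wrt_append less_imp_le)
qed simp

lemma last_index_le:
  assumes "\<forall>(i, r) \<in> set P. r > 0" "set (letters P) \<subseteq> {..M}"
  shows "last_index P \<le> M"
proof (cases "P = []")
  case False
  then have "fst (last P) \<in> set (letters P)"
    using assms(1) by (simp add: set_letters)
  then show ?thesis using assms(2) False by (auto simp: last_index_def)
qed (simp add: last_index_def)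

lemma pos_word_replicate_pow:
  "pos_word (replicate r i @ p) = (thompson_gen i [^]\<^bsub>thompson_G\<^esub> r) \<otimes>\<^bsub>thompson_G\<^esub> pos_word p"
proof -
  interpret group thompson_G by (rule group_thompson_G)
  show ?thesis
  proof (induction r)
    case 0
    then show ?case using pos_word_in_G by simp
  next
    case (Suc r)
    have "pos_word (replicate (Suc r) i @ p)
        = thompson_gen i \<otimes>\<^bsub>thompson_G\<^esub> pos_word (replicate r i @ p)"
      by (simp add: thompson_mult)
    also have "\<dots> = thompson_gen i [^]\<^bsub>thompson_G\<^esub> Suc r \<otimes>\<^bsub>thompson_G\<^esub> pos_word p"
      unfolding Suc nat_pow_Suc2[OF thompson_gen_in_G]
      by (simp add: m_assoc pos_word_in_G thompson_gen_in_G)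
    finally show ?case .
  qed
qed

text \<open>The negative part, multiplied by the positive word of its own letters, collapses from the inside
  to the identity.\<close>

lemma represents_normal_form:
  assumes "normal_form_of P N f"
  shows "represents (letters P) (letters N) f"
proof -
  interpret group thompson_G by (rule group_thompson_G)
  define pos where "pos = (\<lambda>(i, r::nat). thompson_gen i [^]\<^bsub>thompson_G\<^esub> int r)"
  define neg where "neg = (\<lambda>(j, s::nat). thompson_gen j [^]\<^bsub>thompson_G\<^esub> (- int s))"
  have carr: "set (map pos Q) \<subseteq> carrier thompson_G" "set (map neg Q) \<subseteq> carrier thompson_G" for Q
    using thompson_gen_in_G by (auto simp: pos_def neg_def)
  have pos: "list_prod thompson_G (map pos Q) = pos_word (letters Q)" for Q
  proof (induction Q)
    case (Cons a Q)
    then show ?case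
      by (cases a) (simp add: list_prod_def pos_def int_pow_int pos_word_replicate_pow)
  qed (simp add: list_prod_def thompson_one)
  have neg: "list_prod thompson_G (map neg (rev Q)) \<otimes>\<^bsub>thompson_G\<^esub> pos_word (letters Q)
      = \<one>\<^bsub>thompson_G\<^esub>" for Q
  proof (induction Q)
    case (Cons a Q)
    obtain j s where a: "a = (j, s)" by (cases a)
    let ?g = "thompson_gen j [^]\<^bsub>thompson_G\<^esub> s"
    have g: "?g \<in> carrier thompson_G" using thompson_gen_in_G by simp
    have neg_a: "neg a = inv\<^bsub>thompson_G\<^esub> ?g"
      using thompson_gen_in_G by (simp add: a neg_def int_pow_neg int_pow_int)
    have L: "list_prod thompson_G (map neg (rev Q)) \<in> carrier thompson_G"
      using carr by (intro list_prod_closed)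
    have "list_prod thompson_G (map neg (rev (a # Q)))
        = list_prod thompson_G (map neg (rev Q)) \<otimes>\<^bsub>thompson_G\<^esub> inv\<^bsub>thompson_G\<^esub> ?g"
      using list_prod_append[of "map neg (rev Q)" "[neg a]"] carr(2)[of "rev Q"] carr(2)[of "[a]"] g
      by (simp add: list_prod_def neg_a)
    moreover have "pos_word (letters (a # Q)) = ?g \<otimes>\<^bsub>thompson_G\<^esub> pos_word (letters Q)"
      by (simp add: a pos_word_replicate_pow)
    ultimately have "list_prod thompson_G (map neg (rev (a # Q))) \<otimes>\<^bsub>thompson_G\<^esub> pos_word (letters (a # Q))
        = list_prod thompson_G (map neg (rev Q)) \<otimes>\<^bsub>thompson_G\<^esub>
          (inv\<^bsub>thompson_G\<^esub> ?g \<otimes>\<^bsub>thompson_G\<^esub> (?g \<otimes>\<^bsub>thompson_G\<^esub> pos_word (letters Q)))"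
      using L g pos_word_in_G by (simp add: m_assoc)
    also have "\<dots> = \<one>\<^bsub>thompson_G\<^esub>"
      using g pos_word_in_G Cons by (simp add: m_assoc[symmetric])
    finally show ?case .
  qed (simp add: list_prod_def thompson_one thompson_mult)
  have "f = list_prod thompson_G (map pos P @ map neg (rev N))"
    using assms by (simp add: normal_form_of_def pos_def neg_def)
  also have "\<dots> = pos_word (letters P) \<otimes>\<^bsub>thompson_G\<^esub> list_prod thompson_G (map neg (rev N))"
    using carr by (simp only: list_prod_append pos)
  finally have "f \<otimes>\<^bsub>thompson_G\<^esub> pos_word (letters N) = pos_word (letters P)"
    using neg[of N] pos_word_in_G list_prod_closed[OF carr(2)] by (simp add: m_assoc del: map_map)
  then show ?thesis by (simp add: represents_def thompson_mult)
qed

theorem proposition2: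
  fixes f :: "real \<Rightarrow> real" and P N :: "(nat \<times> nat) list"
  assumes "f \<in> carrier thompson_G"
    and "normal_form_of P N f"
  shows "real (normal_form_D P N) / 6 - 2
           \<le> real (word_norm thompson_G {thompson_gen 0, thompson_gen 1} f)
       \<and> real (word_norm thompson_G {thompson_gen 0, thompson_gen 1} f)
           \<le> 3 * real (normal_form_D P N)"
proof -
  interpret group thompson_G by (rule group_thompson_G)
  let ?S = "{thompson_gen 0, thompson_gen 1}"
  let ?p = "letters P" and ?q = "letters N"
  have pos: "\<forall>(i, r) \<in> set P. r > 0" "\<forall>(i, r) \<in> set N. r > 0"
    and incr: "sorted_wrt (<) (map fst P)" "sorted_wrt (<) (map fst N)"
    using assms(2) by (simp_all add: normal_form_of_def)
  have rep: "represents ?p ?q f" by (rule represents_normal_form[OF assms(2)])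
  have sorted: "sorted ?p" "sorted ?q" using incr by (simp_all add: sorted_letters)
  have red: "reduced ?p ?q"
    using assms(2) pos by (auto simp: reduced_def set_letters normal_form_of_def)
  have S: "?S \<subseteq> carrier thompson_G" using thompson_gen_in_G by auto
  have "f \<otimes>\<^bsub>thompson_G\<^esub> pos_word ?q = pos_word ?p"
    using rep by (simp add: represents_def thompson_mult)
  then have f: "f = pos_word ?p \<otimes>\<^bsub>thompson_G\<^esub> inv\<^bsub>thompson_G\<^esub> pos_word ?q"
    using assms(1) pos_word_in_G by (simp add: inv_solve_right)
  have bound: "expressible thompson_G ?S (length (letters Q) + 2 * last_index Q) (pos_word (letters Q))"
    if "\<forall>(i, r) \<in> set Q. r > 0" "sorted_wrt (<) (map fst Q)" for Q
    using letters_le_last_index[OF that] sorted_letters[OF that(2)]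
    by (intro expressible_pos_word) auto
  have expr: "expressible thompson_G ?S
      ((length ?p + 2 * last_index P) + (length ?q + 2 * last_index N)) f"
    unfolding f by (intro expressible_mult expressible_inv S bound pos incr)
  from word_norm_le[OF this]
  have upper: "word_norm thompson_G ?S f \<le> 3 * normal_form_D P N"
    by (simp add: normal_form_D_def length_letters)
  obtain w where w: "set w \<subseteq> ?S \<union> m_inv thompson_G ` ?S"
    "length w = word_norm thompson_G ?S f" "list_prod thompson_G w = f"
    using word_norm_word[OF expr] by blast
  obtain p q where pq: "sorted p" "sorted q" "represents p q f"
    "length p + length q \<le> length w" "set p \<union> set q \<subseteq> {..length w}"
    using word_fraction[OF w(1)] w(3) by blast
  have "length ?p \<le> length p" "length ?q \<le> length q"
    "set ?p \<subseteq> {..length w}" "set ?q \<subseteq> {..length w}"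
    using reduced_minimal[OF rep sorted red pq(3,1,2)] pq(5) by auto
  moreover from this have "last_index P \<le> length w" "last_index N \<le> length w"
    by (simp_all add: last_index_le pos)
  ultimately have "normal_form_D P N \<le> 3 * word_norm thompson_G ?S f"
    using pq(4) w(2) by (simp add: normal_form_D_def length_letters)
  with upper show ?thesis by linarith
qed

end
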